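(* A graph $G$ is a $2$-distance graph if and only if, for each $v\in V(G)$ with $\deg_G(v)\ge \frac{1}{2}|V(G)|$ and for each $a\in N_G(v)$, there exists $b\in V(G)$ such that $b\notin N_G(v)\cup N_G(a)$.
   Context: All graphs are finite and simple, but not necessarily connected. $N_G(v)$ is the set of all vertices of $G$ adjacent to $v$, and $\deg_G(v)=|N_G(v)|$. For vertices $u,v$ of a graph $X$, $\mathrm{dist}_X(u,v)$ is the length of a shortest $u$-$v$ path in $X$ ($\infty$ if $u$ and $v$ lie in different components). The $2$-distance graph $T_2(X)$ of $X$ is the graph with vertex set $V(X)$ in which $u,v$ are adjacent if and only if $\mathrm{dist}_X(u,v)=2$. A graph $G$ is called a $2$-distance graph if there exists a graph $X$ with $T_2(X)=G$, where equality refers to graph isomorphism. *)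

theory Defs
  imports
    Complex_Main
    "HOL-Library.Extended_Nat"
    "Graph_Theory.Pair_Digraph"
    "Graph_Theory.Digraph_Isomorphism"
begin

text \<open>
  A finite simple graph is a digraph without parallel arcs in the locale \<^locale>\<open>pair_graph\<close>:
  finite, symmetric and loop-free, with each edge represented by its two opposite arcs.
  The null graph is included.
\<close>

definition neighbours :: "'a pair_pre_digraph \<Rightarrow> 'a \<Rightarrow> 'a set" where
  "neighbours G v = {u \<in> pverts G. v \<rightarrow>\<^bsub>with_proj G\<^esub> u}"

definition degree :: "'a pair_pre_digraph \<Rightarrow> 'a \<Rightarrow> nat" where
  "degree G v = card (neighbours G v)"

text \<open>The infimum of the empty set in \<^typ>\<open>enat\<close> is infinity, so vertices in different
  components are at infinite distance.\<close>

definition gdist :: "'a pair_pre_digraph \<Rightarrow> 'a \<Rightarrow> 'a \<Rightarrow> enat" where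
  "gdist X u v = (INF p \<in> {p. pre_digraph.apath (with_proj X) u p v}. enat (length p))"

definition T2 :: "'a pair_pre_digraph \<Rightarrow> 'a pair_pre_digraph" where
  "T2 X = \<lparr> pverts = pverts X,
            parcs = {(u, v). u \<in> pverts X \<and> v \<in> pverts X \<and> gdist X u v = 2} \<rparr>"

text \<open>Taking the vertices of \<open>X\<close> in the same type as those of \<open>G\<close> is no restriction, see
  \<open>two_distance_graphI\<close> below.\<close>

definition two_distance_graph :: "'a pair_pre_digraph \<Rightarrow> bool" where
  "two_distance_graph G \<longleftrightarrow>
     (\<exists>X :: 'a pair_pre_digraph. pair_graph X \<and> digraph_iso (with_proj (T2 X)) (with_proj G))"

lemma pcas_map:
  assumes "inj_on h V" "u \<in> V" "v \<in> V" "set p \<subseteq> V \<times> V"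
  shows "pcas (h u) (map (map_prod h h) p) (h v) \<longleftrightarrow> pcas u p v"
  using assms by (induction p arbitrary: u) (auto simp: inj_on_eq_iff)

lemma pawalk_verts_map:
  "pawalk_verts (h u) (map (map_prod h h) p) = map h (pawalk_verts u p)"
  by (induction p arbitrary: u) auto

lemma pawalk_verts_subset:
  "u \<in> V \<Longrightarrow> set p \<subseteq> V \<times> V \<Longrightarrow> set (pawalk_verts u p) \<subseteq> V"
  by (induction p arbitrary: u) (auto, blast)

lemma apath_pair:
  "pre_digraph.apath (with_proj X) u p v \<longleftrightarrow>
     u \<in> pverts X \<and> set p \<subseteq> parcs X \<and> pcas u p v \<and> distinct (pawalk_verts u p)"
  by (simp add: pre_digraph.apath_def pre_digraph.awalk_def cas_with_proj_eq
      awalk_verts_with_proj_eq)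

lemma gdist_image:
  assumes inj: "inj_on h (pverts X)" and sub: "parcs X \<subseteq> pverts X \<times> pverts X"
    and uv: "u \<in> pverts X" "v \<in> pverts X"
  defines "Y \<equiv> \<lparr> pverts = h ` pverts X, parcs = map_prod h h ` parcs X \<rparr>"
  shows "gdist Y (h u) (h v) = gdist X u v"
proof -
  let ?m = "map (map_prod h h)"
  have ap: "pre_digraph.apath (with_proj Y) (h u) (?m p) (h v)
      \<longleftrightarrow> pre_digraph.apath (with_proj X) u p v" if p: "set p \<subseteq> parcs X" for p
  proof -
    have p': "set p \<subseteq> pverts X \<times> pverts X" using p sub by blast
    have "inj_on h (set (pawalk_verts u p))"
      using inj pawalk_verts_subset[OF uv(1) p'] by (rule inj_on_subset)
    then show ?thesis
      using p uv by (auto simp: apath_pair Y_def pcas_map[OF inj uv p'] pawalk_verts_map distinct_map)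
  qed
  have "{q. pre_digraph.apath (with_proj Y) (h u) q (h v)}
      = ?m ` {p. pre_digraph.apath (with_proj X) u p v}" (is "?L = ?R")
  proof (intro subset_antisym subsetI)
    fix q assume q: "q \<in> ?L"
    then have "q \<in> lists (map_prod h h ` parcs X)"
      by (auto simp: apath_pair Y_def)
    then obtain p where "q = ?m p" "set p \<subseteq> parcs X"
      by (auto simp: lists_image)
    with q ap show "q \<in> ?R" by auto
  next
    fix q assume "q \<in> ?R"
    then obtain p where p: "q = ?m p" "pre_digraph.apath (with_proj X) u p v" by auto
    then have "set p \<subseteq> parcs X" by (simp add: apath_pair)
    with p ap show "q \<in> ?L" by auto
  qed
  then show ?thesis by (simp add: gdist_def image_image)
qed

lemma two_distance_graphI:
  fixes X :: "'b pair_pre_digraph" and G :: "'a pair_pre_digraph"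
  assumes X: "pair_graph X" and iso: "digraph_iso (with_proj (T2 X)) (with_proj G)"
  shows "two_distance_graph G"
proof -
  interpret X: pair_graph X by fact
  from iso obtain f where f: "pre_digraph.digraph_isomorphism (with_proj (T2 X)) f"
    and G: "with_proj G = app_iso f (with_proj (T2 X))"
    by (auto simp: digraph_iso_def)
  define h where "h = iso_verts f"
  have inj: "inj_on h (pverts X)"
    using f by (auto simp: pre_digraph.digraph_isomorphism_def h_def T2_def)
  have tail_head: "iso_tail f = fst" "iso_head f = snd"
    using arg_cong[OF G, of tail] arg_cong[OF G, of head] by (auto simp: app_iso_def)
  have arcs: "iso_arcs f e = map_prod h h e" if "e \<in> parcs (T2 X)" for e
    using f that tail_head
    by (auto simp: pre_digraph.digraph_isomorphism_def h_def prod_eq_iff)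
  have GV: "pverts G = h ` pverts X"
    using arg_cong[OF G, of verts] by (simp add: h_def T2_def)
  have GA: "parcs G = map_prod h h ` parcs (T2 X)"
    using arg_cong[OF G, of "pre_digraph.arcs"] arcs by simp
  have sub: "parcs X \<subseteq> pverts X \<times> pverts X"
    using X.wellformed' by auto
  define Y where "Y = \<lparr> pverts = h ` pverts X, parcs = map_prod h h ` parcs X \<rparr>"
  have dist: "gdist Y (h u) (h v) = gdist X u v" if "u \<in> pverts X" "v \<in> pverts X" for u v
    unfolding Y_def using gdist_image[OF inj sub that] .
  have "pair_graph Y"
  proof unfold_locales
    show "symmetric (with_proj Y)"
      using X.pair_sym_arcs by (auto simp: symmetric_def sym_def Y_def)
    show "fst e \<noteq> snd e" if "e \<in> parcs Y" for e
    proof -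
      from that obtain a b where ab: "(a, b) \<in> parcs X" "e = (h a, h b)"
        by (auto simp: Y_def)
      with X.pair_no_loops[OF ab(1)] X.wellformed'[OF ab(1)] inj show ?thesis
        by (auto simp: inj_on_eq_iff)
    qed
  qed (use sub X.pair_finite_verts X.pair_finite_arcs in \<open>auto simp: Y_def\<close>)
  moreover have "G = T2 Y"
  proof (rule pair_pre_digraph.equality)
    show "pverts G = pverts (T2 Y)" by (simp add: GV T2_def Y_def)
    have "pverts Y = h ` pverts X" by (simp add: Y_def)
    then show "parcs G = parcs (T2 Y)"
      unfolding GA by (auto simp: T2_def dist intro!: image_eqI[of _ _ "(_, _)"])
  qed simp
  moreover have "digraph_iso (with_proj (T2 Y)) (with_proj (T2 Y))"
  proof -
    let ?f = "\<lparr> iso_verts = id, iso_arcs = id, iso_head = snd, iso_tail = fst \<rparr>"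
    have "wf_digraph (with_proj (T2 Y))"
      by unfold_locales (auto simp: T2_def)
    then have "pre_digraph.digraph_isomorphism (with_proj (T2 Y)) ?f"
      by (auto simp: pre_digraph.digraph_isomorphism_def)
    moreover have "with_proj (T2 Y) = app_iso ?f (with_proj (T2 Y))"
      by (simp add: app_iso_def with_proj_def)
    ultimately show ?thesis unfolding digraph_iso_def by blast
  qed
  ultimately show ?thesis unfolding two_distance_graph_def by auto
qed

end

theory Submission
  imports Defs
begin

text \<open>
  Call an edge \<open>va\<close> of \<open>G\<close> escaped if some vertex lies outside \<open>N(v) \<union> N(a)\<close>; such a vertex
  is automatically different from \<open>v\<close> and \<open>a\<close>. The theorem splits into two observations.

  First, \<open>G\<close> is a 2-distance graph if and only if all of its edges are escaped
  (lemmas \<open>common_nonneighbour_of_T2\<close> and \<open>T2_complement\<close>). If \<open>G = T\<^sub>2(X)\<close>, then no edge of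
  \<open>X\<close> is an edge of \<open>G\<close>, so the midpoint of a shortest \<open>v\<close>-\<open>a\<close> path in \<open>X\<close> is \<open>G\<close>-adjacent to
  neither end. Conversely, if all edges of \<open>G\<close> are escaped, then \<open>X\<close> can be taken to be the
  complement of \<open>G\<close>: two vertices at distance 2 in the complement are adjacent in \<open>G\<close>, and an
  edge \<open>va\<close> of \<open>G\<close> is bridged in the complement by the vertex that escapes it.

  Second, an edge whose two ends both have degree below \<open>|V(G)| / 2\<close> is always escaped, since
  the two neighbourhoods together have fewer than \<open>|V(G)|\<close> elements
  (lemma \<open>common_nonneighbour_of_small_degrees\<close>). As escaping is symmetric in \<open>v\<close> and \<open>a\<close>, it
  is therefore enough to demand it at the vertices of degree at least \<open>|V(G)| / 2\<close>.
\<close>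

lemma neighbours_iff:
  assumes "pair_graph G"
  shows "u \<in> neighbours G v \<longleftrightarrow> (v, u) \<in> parcs G"
proof -
  interpret pair_graph G by fact
  show ?thesis
    using wellformed' by (auto simp: neighbours_def arcs_ends_def arc_to_ends_def)
qed

lemma parcs_sym:
  assumes "pair_graph G" "(u, v) \<in> parcs G"
  shows "(v, u) \<in> parcs G"
proof -
  interpret pair_graph G by fact
  show ?thesis
    using pair_sym_arcs assms(2) by (auto simp: symmetric_def sym_def)
qed

text \<open>Distances are attained, because \<^typ>\<open>enat\<close> is well-ordered and an infimum that is finite
  is not the infimum of the empty set.\<close>

lemma gdist_attained:
  assumes "gdist X u v = enat n"
  shows "\<exists>p. pre_digraph.apath (with_proj X) u p v \<and> length p = n"
proof -
  let ?L = "(\<lambda>p. enat (length p)) ` {p. pre_digraph.apath (with_proj X) u p v}"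
  have "?L \<noteq> {}"
    using assms unfolding gdist_def Inf_enat_def by (metis enat.distinct(1))
  then have "Inf ?L \<in> ?L"
    unfolding Inf_enat_def by (metis (full_types) LeastI_ex ex_in_conv)
  then show ?thesis
    using assms by (auto simp: gdist_def)
qed

lemma gdist_le:
  assumes "pre_digraph.apath (with_proj X) u p v"
  shows "gdist X u v \<le> enat (length p)"
  unfolding gdist_def using assms by (auto intro: INF_lower)

lemma gdist_eq_2_iff:
  assumes "pair_graph X"
  shows "gdist X u v = 2 \<longleftrightarrow>
    u \<noteq> v \<and> (u, v) \<notin> parcs X \<and> (\<exists>w. (u, w) \<in> parcs X \<and> (w, v) \<in> parcs X)"
    (is "_ \<longleftrightarrow> ?R")
proof -
  interpret X: pair_graph X by fact
  have noloop: "a \<noteq> b" if "(a, b) \<in> parcs X" for a b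
    using X.pair_no_loops[OF that] by simp
  have two: "(2::enat) = enat 2"
    by (simp add: numeral_eq_enat)
  show ?thesis
  proof
    assume d: "gdist X u v = 2"
    then obtain p where p: "pre_digraph.apath (with_proj X) u p v" and "length p = 2"
      using gdist_attained two by metis
    then obtain e f where "p = [e, f]"
      by (auto simp: numeral_2_eq_2 length_Suc_conv)
    with p have uv: "u \<in> pverts X" "u \<noteq> v"
      and mid: "(u, snd e) \<in> parcs X" "(snd e, v) \<in> parcs X"
      by (cases e; cases f; auto simp: apath_pair)+
    have "(u, v) \<notin> parcs X"
    proof
      assume "(u, v) \<in> parcs X"
      with uv have "pre_digraph.apath (with_proj X) u [(u, v)] v"
        by (simp add: apath_pair)
      from gdist_le[OF this] show False
        using d two by simp
    qed
    with uv mid show ?R by blast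
  next
    assume ?R
    then obtain w where w: "u \<noteq> v" "(u, v) \<notin> parcs X" "(u, w) \<in> parcs X" "(w, v) \<in> parcs X"
      by blast
    have "pre_digraph.apath (with_proj X) u [(u, w), (w, v)] v"
      using w noloop X.wellformed' by (auto simp: apath_pair)
    then have le: "gdist X u v \<le> enat 2"
      using gdist_le[of X u "[(u, w), (w, v)]" v] by (simp add: numeral_2_eq_2)
    then obtain n where n: "gdist X u v = enat n" "n \<le> 2"
      by (cases "gdist X u v") auto
    obtain p where p: "pre_digraph.apath (with_proj X) u p v" "length p = n"
      using gdist_attained[OF n(1)] by blast
    have "n \<noteq> 0"
      using p w(1) by (auto simp: apath_pair)
    moreover have "n \<noteq> 1"
    proof
      assume "n = 1"
      with p(2) obtain e where "p = [e]"
        by (auto simp: length_Suc_conv)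
      with p(1) w(2) show False
        by (cases e) (auto simp: apath_pair)
    qed
    ultimately show "gdist X u v = 2"
      using n two by (simp add: le_Suc_eq numeral_2_eq_2)
  qed
qed

text \<open>An isomorphism of digraphs also maps arcs and incidence functions; between two graphs whose
  arcs are pairs, it is determined by an injection of the vertices.\<close>

lemma digraph_iso_with_projE:
  assumes "digraph_iso (with_proj H) (with_proj G)"
  obtains h where "inj_on h (pverts H)" "pverts G = h ` pverts H"
    "parcs G = map_prod h h ` parcs H"
proof -
  from assms obtain f where f: "pre_digraph.digraph_isomorphism (with_proj H) f"
    and G: "with_proj G = app_iso f (with_proj H)"
    by (auto simp: digraph_iso_def)
  have tail_head: "iso_tail f = fst" "iso_head f = snd"
    using arg_cong[OF G, of tail] arg_cong[OF G, of head] by (auto simp: app_iso_def)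
  have arcs: "iso_arcs f e = map_prod (iso_verts f) (iso_verts f) e" if "e \<in> parcs H" for e
    using f that tail_head by (auto simp: pre_digraph.digraph_isomorphism_def prod_eq_iff)
  show thesis
  proof (rule that)
    show "inj_on (iso_verts f) (pverts H)"
      using f by (auto simp: pre_digraph.digraph_isomorphism_def)
    show "pverts G = iso_verts f ` pverts H"
      using arg_cong[OF G, of verts] by simp
    show "parcs G = map_prod (iso_verts f) (iso_verts f) ` parcs H"
      using arg_cong[OF G, of "pre_digraph.arcs"] arcs by simp
  qed
qed

text \<open>The vertex asked for is the image of the midpoint of a shortest path in \<open>X\<close>: the
  midpoint is joined to both ends by edges of \<open>X\<close>, and the ends of such an edge are at distance 1
  rather than 2, so their images are not adjacent in \<open>G\<close>.\<close>

lemma common_nonneighbour_of_T2: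
  assumes X: "pair_graph X" and iso: "digraph_iso (with_proj (T2 X)) (with_proj G)"
    and va: "(v, a) \<in> parcs G"
  shows "\<exists>b \<in> pverts G. (v, b) \<notin> parcs G \<and> (a, b) \<notin> parcs G"
proof -
  interpret X: pair_graph X by fact
  obtain h where inj: "inj_on h (pverts X)" and GV: "pverts G = h ` pverts X"
    and GA: "parcs G = map_prod h h ` parcs (T2 X)"
    using digraph_iso_with_projE[OF iso] by (auto simp: T2_def)
  have nonadj: "(h x, h y) \<notin> parcs G" if xy: "(x, y) \<in> parcs X" for x y
  proof
    assume "(h x, h y) \<in> parcs G"
    then obtain x' y' where *: "h x = h x'" "h y = h y'" "x' \<in> pverts X" "y' \<in> pverts X"
      "gdist X x' y' = 2"
      by (auto simp: GA T2_def)
    with inj X.wellformed'[OF xy] have "x = x'" "y = y'"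
      by (auto simp: inj_on_eq_iff)
    with * xy show False
      by (simp add: gdist_eq_2_iff[OF X])
  qed
  from va obtain x y where "v = h x" "a = h y" "gdist X x y = 2"
    by (auto simp: GA T2_def)
  moreover from this obtain w where "(x, w) \<in> parcs X" "(w, y) \<in> parcs X"
    by (auto simp: gdist_eq_2_iff[OF X])
  ultimately show ?thesis
    using nonadj parcs_sym[OF X] X.wellformed' GV by blast
qed

definition pair_complement :: "'a pair_pre_digraph \<Rightarrow> 'a pair_pre_digraph" where
  "pair_complement G = \<lparr> pverts = pverts G,
     parcs = {(u, v) \<in> pverts G \<times> pverts G. u \<noteq> v \<and> (u, v) \<notin> parcs G} \<rparr>"

lemma pair_graph_pair_complement:
  assumes "pair_graph G"
  shows "pair_graph (pair_complement G)"
proof -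
  interpret pair_graph G by fact
  have "parcs (pair_complement G) \<subseteq> pverts G \<times> pverts G"
    by (auto simp: pair_complement_def)
  then have "finite (parcs (pair_complement G))"
    by (rule finite_subset) simp
  then show ?thesis
    using parcs_sym[OF assms]
    by unfold_locales (auto simp: pair_complement_def symmetric_def sym_def)
qed

text \<open>The vertex \<open>b\<close> differs from \<open>v\<close> and \<open>a\<close>, which are adjacent to each other, so it is
  adjacent to both of them in the complement.\<close>

lemma T2_complement:
  assumes G: "pair_graph G"
    and esc: "\<And>v a. (v, a) \<in> parcs G \<Longrightarrow>
      \<exists>b \<in> pverts G. (v, b) \<notin> parcs G \<and> (a, b) \<notin> parcs G"
  shows "T2 (pair_complement G) = G"
proof -
  interpret G: pair_graph G by fact
  note dist = gdist_eq_2_iff[OF pair_graph_pair_complement[OF G]]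
  have "(u, v) \<in> parcs (T2 (pair_complement G)) \<longleftrightarrow> (u, v) \<in> parcs G" for u v
  proof
    assume "(u, v) \<in> parcs (T2 (pair_complement G))"
    then show "(u, v) \<in> parcs G"
      by (auto simp: T2_def dist) (auto simp: pair_complement_def)
  next
    assume uv: "(u, v) \<in> parcs G"
    then obtain b where b: "b \<in> pverts G" "(u, b) \<notin> parcs G" "(v, b) \<notin> parcs G"
      using esc by blast
    have vu: "(v, u) \<in> parcs G" and bv: "(b, v) \<notin> parcs G"
      using uv b parcs_sym[OF G] by blast+
    have "b \<noteq> u" "b \<noteq> v" "u \<noteq> v"
      using uv vu b G.pair_no_loops[OF uv] by auto
    moreover have "u \<in> pverts G" "v \<in> pverts G"
      using G.wellformed'[OF uv] by auto
    ultimately show "(u, v) \<in> parcs (T2 (pair_complement G))"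
      using uv b bv by (auto simp: T2_def dist) (auto simp: pair_complement_def)
  qed
  then have "parcs (T2 (pair_complement G)) = parcs G"
    by auto
  then show ?thesis
    by (intro pair_pre_digraph.equality) (auto simp: T2_def pair_complement_def)
qed

lemma digraph_iso_refl:
  assumes "pair_graph G"
  shows "digraph_iso (with_proj G) (with_proj G)"
proof -
  interpret pair_graph G by fact
  let ?f = "\<lparr> iso_verts = id, iso_arcs = id, iso_head = snd, iso_tail = fst \<rparr>"
  have "pre_digraph.digraph_isomorphism (with_proj G) ?f"
    using wf_digraph by (auto simp: pre_digraph.digraph_isomorphism_def)
  moreover have "with_proj G = app_iso ?f (with_proj G)"
    by (simp add: app_iso_def with_proj_def)
  ultimately show ?thesis
    unfolding digraph_iso_def by blast
qed

lemma two_distance_graph_iff: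
  assumes G: "pair_graph G"
  shows "two_distance_graph G \<longleftrightarrow>
    (\<forall>(v, a) \<in> parcs G. \<exists>b \<in> pverts G. (v, b) \<notin> parcs G \<and> (a, b) \<notin> parcs G)"
    (is "_ \<longleftrightarrow> ?R")
proof
  assume "two_distance_graph G"
  then show ?R
    unfolding two_distance_graph_def by (auto intro!: common_nonneighbour_of_T2)
next
  assume ?R
  then have "T2 (pair_complement G) = G"
    using T2_complement[OF G] by blast
  then show "two_distance_graph G"
    unfolding two_distance_graph_def
    using pair_graph_pair_complement[OF G] digraph_iso_refl[OF G] by metis
qed

lemma common_nonneighbour_of_small_degrees:
  assumes G: "pair_graph G"
    and small: "2 * degree G v < card (pverts G)" "2 * degree G a < card (pverts G)"
  shows "\<exists>b \<in> pverts G. b \<notin> neighbours G v \<union> neighbours G a"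
proof (rule ccontr)
  interpret pair_graph G by fact
  assume "\<not> ?thesis"
  then have "pverts G \<subseteq> neighbours G v \<union> neighbours G a"
    by blast
  moreover have "finite (neighbours G v \<union> neighbours G a)"
    by (simp add: neighbours_def)
  ultimately have "card (pverts G) \<le> card (neighbours G v \<union> neighbours G a)"
    by (rule card_mono[rotated])
  also have "\<dots> \<le> degree G v + degree G a"
    unfolding degree_def by (rule card_Un_le)
  finally show False
    using small by linarith
qed

theorem theorem2p7:
  fixes G :: "'a pair_pre_digraph"
  assumes "pair_graph G"
  shows "two_distance_graph G \<longleftrightarrow>
    (\<forall>v \<in> pverts G. real (degree G v) \<ge> 1 / 2 * real (card (pverts G)) \<longrightarrow>
      (\<forall>a \<in> neighbours G v. \<exists>b \<in> pverts G. b \<notin> neighbours G v \<union> neighbours G a))"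
    (is "_ \<longleftrightarrow> ?R")
proof -
  interpret pair_graph G by fact
  let ?esc = "\<lambda>v a. \<exists>b \<in> pverts G. b \<notin> neighbours G v \<union> neighbours G a"
  have iff: "two_distance_graph G \<longleftrightarrow> (\<forall>(v, a) \<in> parcs G. ?esc v a)"
    using two_distance_graph_iff[OF assms] by (simp add: neighbours_iff[OF assms])
  show ?thesis
  proof
    assume "two_distance_graph G"
    then show ?R
      using iff by (auto simp: neighbours_iff[OF assms])
  next
    assume R: ?R
    have large: "?esc v a" if va: "(v, a) \<in> parcs G" and "\<not> 2 * degree G v < card (pverts G)"
      for v a
    proof -
      have "real (degree G v) \<ge> 1 / 2 * real (card (pverts G))"
        using that(2) by linarith
      moreover have "v \<in> pverts G" "a \<in> neighbours G v"
        using wellformed'[OF va] va by (auto simp: neighbours_iff[OF assms])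
      ultimately show ?thesis
        using R by blast
    qed
    have "?esc v a" if va: "(v, a) \<in> parcs G" for v a
    proof -
      have "?esc a v \<Longrightarrow> ?esc v a"
        by blast
      then show ?thesis
        using large[OF va] large[OF parcs_sym[OF assms va]]
          common_nonneighbour_of_small_degrees[OF assms, of v a] by blast
    qed
    then show "two_distance_graph G"
      using iff by blast
  qed
qed

end
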